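(* Let $G$ and $H$ be two bounded labeled acyclic digraphs. Then $\Psi(G*H)=\Psi(G)\cdot\Psi(H)$.
   Context: A labeled acyclic digraph $G=(V,E)$ is a directed graph (multiple edges allowed) with no directed cycles, locally finite, with a set $\Lambda$ carrying an arbitrary binary relation $\sim$ and a labeling $\lambda:E\to\Lambda$. It is bounded if it has a unique source $\hat0$ and a unique sink $\hat1$. For a path $p=(e_1,\dots,e_k)$, $k\ge1$, the descent word is $u(p)=u_1\cdots u_{k-1}$ in non-commuting variables ${\bf a},{\bf b}$ with $u_i={\bf a}$ if $\lambda(e_i)\sim\lambda(e_{i+1})$ and $u_i={\bf b}$ otherwise; $\Psi(G)=\sum_p u(p)$ over all directed paths from $\hat0$ to $\hat1$. Product $G*H$ (vertex sets, edge sets and label sets assumed disjoint): vertices $(V(G)-\{\hat1_G\})\cup(V(H)-\{\hat0_H\})$; edges are the edges $e$ of $G$ with $\operatorname{head}(e)\neq\hat1_G$, the edges $f$ of $H$ with $\operatorname{tail}(f)\ne\hat0_H$, and for every pair $(e,f)$ with $\operatorname{head}(e)=\hat1_G$, $\operatorname{tail}(f)=\hat0_H$ a new edge $(e,f)$ from $\operatorname{tail}(e)$ to $\operatorname{head}(f)$. Label set $\Lambda_G\cup\Lambda_H\cup(\Lambda_G\times\Lambda_H)$ with relation: $\lambda\sim\mu$ if $\lambda,\mu\in\Lambda_G$ and $\lambda\sim_G\mu$; $\lambda\sim(\mu_1,\mu_2)$ if $\lambda\in\Lambda_G$ and $\lambda\sim_G\mu_1$; $(\lambda_1,\lambda_2)\sim\mu$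 if $\mu\in\Lambda_H$ and $\lambda_2\sim_H\mu$; $\lambda\sim\mu$ if $\lambda,\mu\in\Lambda_H$ and $\lambda\sim_H\mu$ (no other relations). Labels: edges of $G$ keep $\lambda_G$, edges of $H$ keep $\lambda_H$, and $\lambda((e,f))=(\lambda_G(e),\lambda_H(f))$.
   Formalization: The source and the sink of each bounded digraph are assumed to be different vertices; otherwise the claim fails (G a single vertex, H a directed path with two edges: the product is one edge with Ψ = 1, while Ψ(G) = 0). *)

theory Defs
  imports "Graph_Theory.Arc_Walk" "HOL-Library.Poly_Mapping"
begin

text \<open>The ring of polynomials in the non-commuting variables \<open>a\<close>, \<open>b\<close> is the monoid ring of
  the free monoid on two letters, with integer coefficients.\<close>

datatype ab = Letter_a | Letter_b

text \<open>The product of \<^type>\<open>poly_mapping\<close> is convolution with respect to \<open>+\<close> of the index type,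
  so concatenation of words has to be written additively.\<close>

datatype 'a free_mon = Word (letters: "'a list")

instantiation free_mon :: (type) monoid_add
begin

definition zero_free_mon :: "'a free_mon" where
  "0 = Word []"

definition plus_free_mon :: "'a free_mon \<Rightarrow> 'a free_mon \<Rightarrow> 'a free_mon" where
  "v + w = Word (letters v @ letters w)"

instance
  by standard (simp_all add: zero_free_mon_def plus_free_mon_def)

end

type_synonym ab_poly = "ab free_mon \<Rightarrow>\<^sub>0 int"

definition var_a :: ab_poly where
  "var_a = Poly_Mapping.single (Word [Letter_a]) 1"

definition var_b :: ab_poly where
  "var_b = Poly_Mapping.single (Word [Letter_b]) 1"


text \<open>\<open>labels\<close> is the set \<open>\<Lambda>\<close>; only the restriction of \<open>label_rel\<close> to it is relevant.\<close>

record ('v, 'e, 'l) labeled_digraph =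
  graph_of :: "('v, 'e) pre_digraph"
  labels :: "'l set"
  label_rel :: "'l \<Rightarrow> 'l \<Rightarrow> bool"
  label :: "'e \<Rightarrow> 'l"

definition is_source :: "('v, 'e) pre_digraph \<Rightarrow> 'v \<Rightarrow> bool" where
  "is_source D v \<longleftrightarrow> v \<in> verts D \<and> in_arcs D v = {}"

definition is_sink :: "('v, 'e) pre_digraph \<Rightarrow> 'v \<Rightarrow> bool" where
  "is_sink D v \<longleftrightarrow> v \<in> verts D \<and> out_arcs D v = {}"

text \<open>These denote \<open>0\<close>-hat and \<open>1\<close>-hat; they are meaningful if there is exactly one source
  and exactly one sink.\<close>

definition zero_hat :: "('v, 'e, 'l) labeled_digraph \<Rightarrow> 'v" where
  "zero_hat G = (THE v. is_source (graph_of G) v)"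

definition one_hat :: "('v, 'e, 'l) labeled_digraph \<Rightarrow> 'v" where
  "one_hat G = (THE v. is_sink (graph_of G) v)"

text \<open>Locally finite means that there are only finitely many directed paths between any two
  vertices. (Finiteness of degrees would not make the sum defining \<open>Psi\<close> finite.)\<close>

locale labeled_acyclic_digraph =
  fixes G :: "('v, 'e, 'l) labeled_digraph"
  assumes wf: "wf_digraph (graph_of G)"
    and acyclic: "\<not> (\<exists>p. pre_digraph.cycle (graph_of G) p)"
    and locally_finite: "\<lbrakk>u \<in> verts (graph_of G); v \<in> verts (graph_of G)\<rbrakk>
      \<Longrightarrow> finite {p. pre_digraph.awalk (graph_of G) u p v}"
    and label_in: "e \<in> arcs (graph_of G) \<Longrightarrow> label G e \<in> labels G"

text \<open>The source and the sink are two different vertices. This only excludes graphs whose unique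
  source is also their unique sink, such as the graph with one vertex and no arc. For these the
  product below loses its source or its sink and \<open>Psi\<close> is not multiplicative: if \<open>G\<close> is a single
  vertex and \<open>H\<close> is a directed path with two arcs, the product is a single arc, with \<open>Psi = 1\<close>,
  whereas \<open>Psi G = 0\<close>.\<close>

locale bounded_labeled_acyclic_digraph = labeled_acyclic_digraph +
  assumes unique_source: "\<exists>!v. is_source (graph_of G) v"
    and unique_sink: "\<exists>!v. is_sink (graph_of G) v"
    and source_neq_sink: "zero_hat G \<noteq> one_hat G"


definition descent_word :: "('v, 'e, 'l) labeled_digraph \<Rightarrow> 'e list \<Rightarrow> ab_poly" where
  "descent_word G p =
     (\<Prod>(e, f)\<leftarrow>zip p (tl p). if label_rel G (label G e) (label G f) then var_a else var_b)"

definition Psi :: "('v, 'e, 'l) labeled_digraph \<Rightarrow> ab_poly" where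
  "Psi G = (\<Sum>p | p \<noteq> [] \<and> pre_digraph.awalk (graph_of G) (zero_hat G) p (one_hat G).
     descent_word G p)"


text \<open>\<open>('x, 'y) prod_sum\<close> is the disjoint union \<open>X \<union> Y \<union> X \<times> Y\<close>. It is used for the arcs and
  for the labels of the product; together with the sum type for the vertices it makes the vertex,
  arc and label sets of the two factors disjoint.\<close>

datatype ('x, 'y) prod_sum = InG 'x | InH 'y | InGH 'x 'y

definition star_graph ::
  "('v, 'e, 'l) labeled_digraph \<Rightarrow> ('w, 'f, 'm) labeled_digraph
    \<Rightarrow> ('v + 'w, ('e, 'f) prod_sum) pre_digraph" where
  "star_graph G H =
    \<lparr> verts = Inl ` (verts (graph_of G) - {one_hat G}) \<union> Inr ` (verts (graph_of H) - {zero_hat H}),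
      arcs =
        {InG e | e. e \<in> arcs (graph_of G) \<and> head (graph_of G) e \<noteq> one_hat G} \<union>
        {InH f | f. f \<in> arcs (graph_of H) \<and> tail (graph_of H) f \<noteq> zero_hat H} \<union>
        {InGH e f | e f. e \<in> arcs (graph_of G) \<and> head (graph_of G) e = one_hat G \<and>
                         f \<in> arcs (graph_of H) \<and> tail (graph_of H) f = zero_hat H},
      tail = (\<lambda>InG e \<Rightarrow> Inl (tail (graph_of G) e)
              | InH f \<Rightarrow> Inr (tail (graph_of H) f)
              | InGH e f \<Rightarrow> Inl (tail (graph_of G) e)),
      head = (\<lambda>InG e \<Rightarrow> Inl (head (graph_of G) e)
              | InH f \<Rightarrow> Inr (head (graph_of H) f)
              | InGH e f \<Rightarrow> Inr (head (graph_of H) f)) \<rparr>"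

definition star_labels ::
  "('v, 'e, 'l) labeled_digraph \<Rightarrow> ('w, 'f, 'm) labeled_digraph \<Rightarrow> ('l, 'm) prod_sum set" where
  "star_labels G H =
     InG ` labels G \<union> InH ` labels H \<union> {InGH l m | l m. l \<in> labels G \<and> m \<in> labels H}"

inductive star_rel ::
  "('v, 'e, 'l) labeled_digraph \<Rightarrow> ('w, 'f, 'm) labeled_digraph
    \<Rightarrow> ('l, 'm) prod_sum \<Rightarrow> ('l, 'm) prod_sum \<Rightarrow> bool"
  for G :: "('v, 'e, 'l) labeled_digraph" and H :: "('w, 'f, 'm) labeled_digraph" where
  G_G: "\<lbrakk>l \<in> labels G; l' \<in> labels G; label_rel G l l'\<rbrakk>
    \<Longrightarrow> star_rel G H (InG l) (InG l')"
| G_GH: "\<lbrakk>l \<in> labels G; m1 \<in> labels G; m2 \<in> labels H; label_rel G l m1\<rbrakk>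
    \<Longrightarrow> star_rel G H (InG l) (InGH m1 m2)"
| GH_H: "\<lbrakk>l1 \<in> labels G; l2 \<in> labels H; m \<in> labels H; label_rel H l2 m\<rbrakk>
    \<Longrightarrow> star_rel G H (InGH l1 l2) (InH m)"
| H_H: "\<lbrakk>m \<in> labels H; m' \<in> labels H; label_rel H m m'\<rbrakk>
    \<Longrightarrow> star_rel G H (InH m) (InH m')"

definition star ::
  "('v, 'e, 'l) labeled_digraph \<Rightarrow> ('w, 'f, 'm) labeled_digraph
    \<Rightarrow> ('v + 'w, ('e, 'f) prod_sum, ('l, 'm) prod_sum) labeled_digraph"
  (infixl \<open>\<star>\<close> 70) where
  "G \<star> H =
    \<lparr> graph_of = star_graph G H,
      labels = star_labels G H,
      label_rel = star_rel G H,
      label = (\<lambda>InG e \<Rightarrow> InG (label G e)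
               | InH f \<Rightarrow> InH (label H f)
               | InGH e f \<Rightarrow> InGH (label G e) (label H f)) \<rparr>"

end

theory Submission
  imports Defs
begin

text \<open>A path of \<open>G \<star> H\<close> from the source to the sink crosses from \<open>G\<close> to \<open>H\<close> along exactly one arc
  \<open>InGH e f\<close>; cutting that arc into \<open>e\<close> and \<open>f\<close> yields a path of \<open>G\<close> ending in \<open>e\<close> and a path of
  \<open>H\<close> starting with \<open>f\<close>. The descent before the crossing arc only sees the label of \<open>e\<close>, the one
  after it only the label of \<open>f\<close>, so the descent word is the product of the two descent words.\<close>

section \<open>Descent words as products of letters\<close>

lemma descent_word_single [simp]: "descent_word G [e] = 1"
  by (simp add: descent_word_def)

lemma descent_word_Cons_Cons [simp]:
  "descent_word G (e # f # p) =
    (if label_rel G (label G e) (label G f) then var_a else var_b) * descent_word G (f # p)"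
  by (simp add: descent_word_def)

text \<open>Each letter depends only on how the labels of two consecutive arcs are related, so the
  word survives any arc map preserving that relation. Applied below to the embedding
  \<open>InH\<close>.\<close>

lemma descent_word_cong:
  assumes "\<And>e f. \<lbrakk>e \<in> set p; f \<in> set p\<rbrakk> \<Longrightarrow>
    label_rel G (label G e) (label G f) = label_rel H (label H (h e)) (label H (h f))"
  shows "descent_word H (map h p) = descent_word G p"
  using assms
proof (induction p rule: induct_list012)
  case (3 e f p)
  then show ?case by simp
qed (simp_all add: descent_word_def)

section \<open>Cutting and joining paths\<close>

text \<open>List values let an absent component be \<open>[]\<close>, so that concatenating over a
  joined path gives back its first half.\<close>

fun arc_fst :: "('e, 'f) prod_sum \<Rightarrow> 'e list" where
  "arc_fst (InG e) = [e]"
| "arc_fst (InH f) = []"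
| "arc_fst (InGH e f) = [e]"

fun arc_snd :: "('e, 'f) prod_sum \<Rightarrow> 'f list" where
  "arc_snd (InG e) = []"
| "arc_snd (InH f) = [f]"
| "arc_snd (InGH e f) = [f]"

text \<open>Intended for nonempty paths, where \<open>last p\<close> and \<open>hd q\<close> are the
  arcs merged into the crossing arc.\<close>

definition join_paths :: "'e list \<Rightarrow> 'f list \<Rightarrow> ('e, 'f) prod_sum list" where
  "join_paths p q = map InG (butlast p) @ InGH (last p) (hd q) # map InH (tl q)"

lemma join_paths_simp [simp]:
  "join_paths (p @ [e]) (f # q) = map InG p @ InGH e f # map InH q"
  by (simp add: join_paths_def)

lemma concat_map_arc_fst [simp]:
  "concat (map (arc_fst \<circ> InG) p) = p" "concat (map (arc_fst \<circ> InH) q) = []"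
  by (induction p; simp) (induction q; simp)

lemma concat_map_arc_snd [simp]:
  "concat (map (arc_snd \<circ> InG) p) = []" "concat (map (arc_snd \<circ> InH) q) = q"
  by (induction p; simp) (induction q; simp)

text \<open>First half of a left inverse of joining, used for injectivity. An empty path could not
  be recovered, since the crossing arc contributes an arc to each half.\<close>

lemma concat_arc_fst_join_paths:
  assumes "p \<noteq> []" "q \<noteq> []"
  shows "concat (map arc_fst (join_paths p q)) = p"
  using assms by (cases p rule: rev_cases; cases q) simp_all

lemma concat_arc_snd_join_paths:
  assumes "p \<noteq> []" "q \<noteq> []"
  shows "concat (map arc_snd (join_paths p q)) = q"
  using assms by (cases p rule: rev_cases; cases q) simp_all

section \<open>Source and sink of a bounded digraph\<close>

context bounded_labeled_acyclic_digraph
begin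

sublocale wf_digraph "graph_of G"
  by (rule wf)

lemma is_source_iff: "is_source (graph_of G) v \<longleftrightarrow> v = zero_hat G"
  using theI'[OF unique_source] unique_source unfolding zero_hat_def by blast

lemma is_sink_iff: "is_sink (graph_of G) v \<longleftrightarrow> v = one_hat G"
  using theI'[OF unique_sink] unique_sink unfolding one_hat_def by blast

lemma zero_hat_in_verts: "zero_hat G \<in> verts (graph_of G)"
  using is_source_iff unfolding is_source_def by blast

lemma one_hat_in_verts: "one_hat G \<in> verts (graph_of G)"
  using is_sink_iff unfolding is_sink_def by blast

lemma head_neq_zero_hat: "e \<in> arcs (graph_of G) \<Longrightarrow> head (graph_of G) e \<noteq> zero_hat G"
  using is_source_iff[of "zero_hat G"] by (auto simp: is_source_def in_arcs_def)

lemma tail_neq_one_hat: "e \<in> arcs (graph_of G) \<Longrightarrow> tail (graph_of G) e \<noteq> one_hat G"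
  using is_sink_iff[of "one_hat G"] by (auto simp: is_sink_def out_arcs_def)

lemma in_arc_exists:
  assumes "v \<in> verts (graph_of G)" "v \<noteq> zero_hat G"
  obtains e where "e \<in> arcs (graph_of G)" "head (graph_of G) e = v"
  using assms is_source_iff[of v] by (auto simp: is_source_def in_arcs_def)

lemma out_arc_exists:
  assumes "v \<in> verts (graph_of G)" "v \<noteq> one_hat G"
  obtains e where "e \<in> arcs (graph_of G)" "tail (graph_of G) e = v"
  using assms is_sink_iff[of v] by (auto simp: is_sink_def out_arcs_def)

text \<open>The index set of the sum in \<open>Psi\<close>, named so that pairs of paths form a
  cartesian product.\<close>

definition paths :: "'b list set" where
  "paths = {p. p \<noteq> [] \<and> awalk (zero_hat G) p (one_hat G)}"

end

section \<open>Arcs, source and sink of the product\<close>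

locale star_product =
  G: bounded_labeled_acyclic_digraph G + H: bounded_labeled_acyclic_digraph H
  for G :: "('v, 'e, 'l) labeled_digraph" and H :: "('w, 'f, 'm) labeled_digraph"
begin

lemma in_arcs_star:
  "InG e \<in> arcs (star_graph G H) \<longleftrightarrow> e \<in> arcs (graph_of G) \<and> head (graph_of G) e \<noteq> one_hat G"
  "InH f \<in> arcs (star_graph G H) \<longleftrightarrow> f \<in> arcs (graph_of H) \<and> tail (graph_of H) f \<noteq> zero_hat H"
  "InGH e f \<in> arcs (star_graph G H) \<longleftrightarrow>
     e \<in> arcs (graph_of G) \<and> head (graph_of G) e = one_hat G \<and>
     f \<in> arcs (graph_of H) \<and> tail (graph_of H) f = zero_hat H"
  by (auto simp: star_graph_def)

lemma tail_star [simp]: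
  "tail (star_graph G H) (InG e) = Inl (tail (graph_of G) e)"
  "tail (star_graph G H) (InH f) = Inr (tail (graph_of H) f)"
  "tail (star_graph G H) (InGH e f) = Inl (tail (graph_of G) e)"
  by (simp_all add: star_graph_def)

lemma head_star [simp]:
  "head (star_graph G H) (InG e) = Inl (head (graph_of G) e)"
  "head (star_graph G H) (InH f) = Inr (head (graph_of H) f)"
  "head (star_graph G H) (InGH e f) = Inr (head (graph_of H) f)"
  by (simp_all add: star_graph_def)

lemma in_verts_star:
  "Inl v \<in> verts (star_graph G H) \<longleftrightarrow> v \<in> verts (graph_of G) \<and> v \<noteq> one_hat G"
  "Inr w \<in> verts (star_graph G H) \<longleftrightarrow> w \<in> verts (graph_of H) \<and> w \<noteq> zero_hat H"
  by (auto simp: star_graph_def)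

sublocale star: wf_digraph "star_graph G H"
proof
  fix x assume "x \<in> arcs (star_graph G H)"
  then show "tail (star_graph G H) x \<in> verts (star_graph G H)"
    and "head (star_graph G H) x \<in> verts (star_graph G H)"
    by (cases x; simp add: in_arcs_star in_verts_star G.tail_neq_one_hat H.head_neq_zero_hat)+
qed

text \<open>A vertex kept from \<open>G\<close> has the same incoming arcs as before, and
  \<open>zero_hat G\<close> is kept because it differs from \<open>one_hat G\<close>. A vertex kept
  from \<open>H\<close> still has an arc entering it.\<close>

lemma is_source_star: "is_source (star_graph G H) x \<longleftrightarrow> x = Inl (zero_hat G)"
proof (cases x)
  case (Inl v)
  have "is_source (star_graph G H) (Inl v) \<longleftrightarrow> v \<noteq> one_hat G \<and> is_source (graph_of G) v"
  proof -
    have "x \<in> in_arcs (star_graph G H) (Inl v) \<longleftrightarrow>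
        (\<exists>e. x = InG e \<and> e \<in> in_arcs (graph_of G) v)" if "v \<noteq> one_hat G" for x
      using that by (cases x) (auto simp: in_arcs_star)
    then show ?thesis
      unfolding is_source_def in_verts_star by blast
  qed
  then show ?thesis
    using Inl G.is_source_iff G.source_neq_sink by auto
next
  case (Inr w)
  have "\<not> is_source (star_graph G H) (Inr w)"
  proof
    assume src: "is_source (star_graph G H) (Inr w)"
    then obtain f where f: "f \<in> arcs (graph_of H)" "head (graph_of H) f = w"
      using H.in_arc_exists by (auto simp: is_source_def in_verts_star)
    \<comment> \<open>Some arc enters \<open>one_hat G\<close>, which is not the source. It serves
      the case that \<open>f\<close> starts at \<open>zero_hat H\<close> and survives only merged
      with such an arc.\<close>
    obtain e where e: "e \<in> arcs (graph_of G)" "head (graph_of G) e = one_hat G"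
      using G.in_arc_exists G.one_hat_in_verts G.source_neq_sink by metis
    have "InH f \<in> in_arcs (star_graph G H) (Inr w) \<or> InGH e f \<in> in_arcs (star_graph G H) (Inr w)"
      using e f by (auto simp: in_arcs_star)
    with src show False
      by (auto simp: is_source_def)
  qed
  then show ?thesis
    using Inr by simp
qed

text \<open>Dual to \<open>is_source_star\<close>, with the roles of the factors exchanged.\<close>

lemma is_sink_star: "is_sink (star_graph G H) x \<longleftrightarrow> x = Inr (one_hat H)"
proof (cases x)
  case (Inr w)
  have "is_sink (star_graph G H) (Inr w) \<longleftrightarrow> w \<noteq> zero_hat H \<and> is_sink (graph_of H) w"
  proof -
    have "x \<in> out_arcs (star_graph G H) (Inr w) \<longleftrightarrow>
        (\<exists>f. x = InH f \<and> f \<in> out_arcs (graph_of H) w)" if "w \<noteq> zero_hat H" for x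
      using that by (cases x) (auto simp: in_arcs_star)
    then show ?thesis
      unfolding is_sink_def in_verts_star by blast
  qed
  then show ?thesis
    using Inr H.is_sink_iff H.source_neq_sink by auto
next
  case (Inl v)
  have "\<not> is_sink (star_graph G H) (Inl v)"
  proof
    assume snk: "is_sink (star_graph G H) (Inl v)"
    then obtain e where e: "e \<in> arcs (graph_of G)" "tail (graph_of G) e = v"
      using G.out_arc_exists by (auto simp: is_sink_def in_verts_star)
    obtain f where f: "f \<in> arcs (graph_of H)" "tail (graph_of H) f = zero_hat H"
      using H.out_arc_exists H.zero_hat_in_verts H.source_neq_sink by metis
    have "InG e \<in> out_arcs (star_graph G H) (Inl v) \<or> InGH e f \<in> out_arcs (star_graph G H) (Inl v)"
      using e f by (auto simp: in_arcs_star)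
    with snk show False
      by (auto simp: is_sink_def)
  qed
  then show ?thesis
    using Inl by simp
qed

lemma graph_of_star [simp]: "graph_of (G \<star> H) = star_graph G H"
  by (simp add: star_def)

lemma zero_hat_star: "zero_hat (G \<star> H) = Inl (zero_hat G)"
  by (simp add: zero_hat_def[of "G \<star> H"] is_source_star)

lemma one_hat_star: "one_hat (G \<star> H) = Inr (one_hat H)"
  by (simp add: one_hat_def[of "G \<star> H"] is_sink_star)

section \<open>Paths of the product\<close>

text \<open>All arcs leaving a vertex of \<open>H\<close> come from \<open>H\<close>, so a walk
  never returns to \<open>G\<close>. The assumption on \<open>w\<close> passes to the next vertex
  because no arc of \<open>H\<close> ends in \<open>zero_hat H\<close>.\<close>

lemma awalk_star_Inr_iff:
  assumes "w \<noteq> zero_hat H"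
  shows "star.awalk (Inr w) xs (Inr z) \<longleftrightarrow> (\<exists>q. xs = map InH q \<and> H.awalk w q z)"
  using assms
proof (induction xs arbitrary: w)
  case Nil
  then show ?case
    by (auto simp: star.awalk_Nil_iff H.awalk_Nil_iff in_verts_star)
next
  case (Cons x xs)
  show ?case
  proof (cases x)
    case (InH f)
    have "star.awalk (Inr w) (InH f # xs) (Inr z) \<longleftrightarrow>
        f \<in> arcs (graph_of H) \<and> w = tail (graph_of H) f \<and>
        star.awalk (Inr (head (graph_of H) f)) xs (Inr z)"
      using Cons.prems by (auto simp: star.awalk_Cons_iff in_arcs_star)
    also have "\<dots> \<longleftrightarrow> (\<exists>q. xs = map InH q \<and> H.awalk w (f # q) z)"
      using Cons.IH[of "head (graph_of H) f"] H.head_neq_zero_hat[of f]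
      by (auto simp: H.awalk_Cons_iff)
    also have "\<dots> \<longleftrightarrow> (\<exists>q. InH f # xs = map InH q \<and> H.awalk w q z)"
      unfolding Cons_eq_map_conv prod_sum.inject by blast
    finally show ?thesis
      using InH by simp
  \<comment> \<open>The other two kinds of arc have their tail in \<open>G\<close>.\<close>
  qed (auto simp: star.awalk_Cons_iff)
qed

lemma awalk_star_joined:
  assumes "G.awalk v (p @ [e]) (one_hat G)" "H.awalk (zero_hat H) (f # q) z"
  shows "star.awalk (Inl v) (map InG p @ InGH e f # map InH q) (Inr z)"
  using assms(1)
proof (induction p arbitrary: v)
  case Nil
  then show ?case
    using assms(2) H.head_neq_zero_hat[of f]
    by (auto simp: star.awalk_Cons_iff G.awalk_Cons_iff G.awalk_Nil_iff H.awalk_Cons_iff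
        in_arcs_star awalk_star_Inr_iff)
next
  case (Cons e' p)
  \<comment> \<open>Another arc follows \<open>e'\<close> in the walk, and no arc leaves
    \<open>one_hat G\<close>; hence \<open>InG e'\<close> is an arc of the product.\<close>
  then have "head (graph_of G) e' \<noteq> one_hat G"
    using G.tail_neq_one_hat by (cases p) (auto simp: G.awalk_Cons_iff)
  then show ?case
    using Cons by (simp add: star.awalk_Cons_iff G.awalk_Cons_iff in_arcs_star
        del: star.awalk_append_iff G.awalk_append_iff)
qed

text \<open>Follow \<open>xs\<close> up to the first arc of the form \<open>InGH e f\<close>. It
  exists because the endpoints lie on different sides, and all that comes after it stays in
  \<open>H\<close> by \<open>awalk_star_Inr_iff\<close>.\<close>

lemma awalk_star_split:
  assumes "star.awalk (Inl v) xs (Inr z)"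
  obtains p e f q where "xs = map InG p @ InGH e f # map InH q"
    "G.awalk v (p @ [e]) (one_hat G)" "H.awalk (zero_hat H) (f # q) z"
  using assms
proof (induction xs arbitrary: v thesis)
  case Nil
  then show ?case
    by (simp add: star.awalk_Nil_iff)
next
  case (Cons x xs)
  show ?case
  proof (cases x)
    case (InG e)
    then have e: "e \<in> arcs (graph_of G)" "v = tail (graph_of G) e"
      and "star.awalk (Inl (head (graph_of G) e)) xs (Inr z)"
      using Cons.prems(2) by (auto simp: star.awalk_Cons_iff in_arcs_star)
    then obtain p e' f q where "xs = map InG p @ InGH e' f # map InH q"
      "G.awalk (head (graph_of G) e) (p @ [e']) (one_hat G)" "H.awalk (zero_hat H) (f # q) z"
      using Cons.IH by blast
    then show ?thesis
      using InG e by (intro Cons.prems(1)[of "e # p" e' f q]) (auto simp: G.awalk_Cons_iff)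
  next
    case (InH f)
    then show ?thesis
      using Cons.prems(2) by (simp add: star.awalk_Cons_iff)
  next
    case (InGH e f)
    then obtain q where "xs = map InH q" "H.awalk (head (graph_of H) f) q z"
      using Cons.prems(2) H.head_neq_zero_hat[of f]
      by (auto simp: star.awalk_Cons_iff in_arcs_star awalk_star_Inr_iff)
    \<comment> \<open>The walk crosses at once: nothing precedes \<open>e\<close>, which already
      ends in \<open>one_hat G\<close>.\<close>
    then show ?thesis
      using InGH Cons.prems(2) G.one_hat_in_verts
      by (intro Cons.prems(1)[of "[]" e f q])
        (auto simp: star.awalk_Cons_iff G.awalk_Cons_iff G.awalk_Nil_iff H.awalk_Cons_iff in_arcs_star)
  qed
qed

text \<open>Injectivity comes from the explicit left inverse \<open>?cut\<close>, surjectivity from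
  \<open>awalk_star_split\<close>.\<close>

lemma bij_betw_join_paths:
  "bij_betw (\<lambda>(p, q). join_paths p q) (G.paths \<times> H.paths)
    {xs. xs \<noteq> [] \<and> star.awalk (Inl (zero_hat G)) xs (Inr (one_hat H))}"
proof (intro bij_betw_imageI inj_on_inverseI equalityI subsetI)
  let ?cut = "\<lambda>xs. (concat (map arc_fst xs), concat (map arc_snd xs))"
  fix x assume "x \<in> G.paths \<times> H.paths"
  then show "?cut (case x of (p, q) \<Rightarrow> join_paths p q) = x"
    by (auto simp: G.paths_def H.paths_def concat_arc_fst_join_paths concat_arc_snd_join_paths)
next
  fix xs assume "xs \<in> (\<lambda>(p, q). join_paths p q) ` (G.paths \<times> H.paths)"
  then obtain p q where pq: "xs = join_paths p q" "p \<in> G.paths" "q \<in> H.paths"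
    by auto
  moreover from pq obtain p' e f q' where "p = p' @ [e]" "q = f # q'"
    by (cases p rule: rev_cases; cases q) (auto simp: G.paths_def H.paths_def)
  ultimately show "xs \<in> {xs. xs \<noteq> [] \<and> star.awalk (Inl (zero_hat G)) xs (Inr (one_hat H))}"
    by (auto simp: G.paths_def H.paths_def intro: awalk_star_joined
        simp del: star.awalk_append_iff G.awalk_append_iff)
next
  fix xs assume "xs \<in> {xs. xs \<noteq> [] \<and> star.awalk (Inl (zero_hat G)) xs (Inr (one_hat H))}"
  then have "star.awalk (Inl (zero_hat G)) xs (Inr (one_hat H))"
    by simp
  then obtain p e f q where "xs = map InG p @ InGH e f # map InH q"
      "G.awalk (zero_hat G) (p @ [e]) (one_hat G)" "H.awalk (zero_hat H) (f # q) (one_hat H)"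
    by (rule awalk_star_split)
  then have "xs = join_paths (p @ [e]) (f # q)" "p @ [e] \<in> G.paths" "f # q \<in> H.paths"
    by (simp_all add: G.paths_def H.paths_def)
  then show "xs \<in> (\<lambda>(p, q). join_paths p q) ` (G.paths \<times> H.paths)"
    by (intro image_eqI[of _ _ "(p @ [e], f # q)"]) auto
qed

section \<open>Descent words in the product\<close>

text \<open>This and the next three lemmas cover exactly the pairs of arc kinds that can be
  consecutive in a joined path. The rules of \<open>star_rel\<close> ask for labels in the label
  sets, which \<open>label_in\<close> supplies.\<close>

lemma label_rel_star_InG_InG:
  "\<lbrakk>e' \<in> arcs (graph_of G); e \<in> arcs (graph_of G)\<rbrakk> \<Longrightarrow>
    label_rel (G \<star> H) (label (G \<star> H) (InG e')) (label (G \<star> H) (InG e)) =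
    label_rel G (label G e') (label G e)"
  by (auto simp: star_def star_rel.simps G.label_in H.label_in)

lemma label_rel_star_InG_InGH:
  "\<lbrakk>e' \<in> arcs (graph_of G); e \<in> arcs (graph_of G); f \<in> arcs (graph_of H)\<rbrakk> \<Longrightarrow>
    label_rel (G \<star> H) (label (G \<star> H) (InG e')) (label (G \<star> H) (InGH e f)) =
    label_rel G (label G e') (label G e)"
  by (auto simp: star_def star_rel.simps G.label_in H.label_in)

lemma label_rel_star_InGH_InH:
  "\<lbrakk>e \<in> arcs (graph_of G); f \<in> arcs (graph_of H); f' \<in> arcs (graph_of H)\<rbrakk> \<Longrightarrow>
    label_rel (G \<star> H) (label (G \<star> H) (InGH e f)) (label (G \<star> H) (InH f')) =
    label_rel H (label H f) (label H f')"
  by (auto simp: star_def star_rel.simps G.label_in H.label_in)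

lemma label_rel_star_InH_InH:
  "\<lbrakk>f \<in> arcs (graph_of H); f' \<in> arcs (graph_of H)\<rbrakk> \<Longrightarrow>
    label_rel (G \<star> H) (label (G \<star> H) (InH f)) (label (G \<star> H) (InH f')) =
    label_rel H (label H f) (label H f')"
  by (auto simp: star_def star_rel.simps G.label_in H.label_in)

text \<open>Only the second component of the crossing label is compared with what follows, so the
  crossing arc acts as \<open>f\<close>.\<close>

lemma descent_word_crossing_arc:
  assumes "e \<in> arcs (graph_of G)" "set (f # q) \<subseteq> arcs (graph_of H)"
  shows "descent_word (G \<star> H) (InGH e f # map InH q) = descent_word H (f # q)"
proof (cases q)
  case (Cons f' q')
  have "descent_word (G \<star> H) (map InH q) = descent_word H q"
    using assms by (intro descent_word_cong) (auto simp: subset_iff label_rel_star_InH_InH)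
  then show ?thesis
    using assms Cons by (simp add: label_rel_star_InGH_InH)
qed simp

text \<open>Induction on \<open>p\<close> strips letters from the left. They belong to the word of
  \<open>G\<close>, the left factor, so associativity suffices to pull them out and no variables
  have to commute.\<close>

lemma descent_word_star:
  assumes "set (p @ [e]) \<subseteq> arcs (graph_of G)" "set (f # q) \<subseteq> arcs (graph_of H)"
  shows "descent_word (G \<star> H) (map InG p @ InGH e f # map InH q) =
    descent_word G (p @ [e]) * descent_word H (f # q)"
  using assms(1)
proof (induction p rule: induct_list012)
  case 1
  then show ?case
    using assms(2) by (simp add: descent_word_crossing_arc)
next
  \<comment> \<open>The last arc before the crossing is compared with \<open>label G e\<close>,
    which gives the final letter of the word of \<open>G\<close>.\<close>
  case (2 e')
  then show ?case
    using assms(2) by (simp add: descent_word_crossing_arc label_rel_star_InG_InGH)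
next
  case (3 e' e'' p)
  then show ?case
    using assms(2) by (simp add: label_rel_star_InG_InG mult.assoc)
qed

lemma descent_word_join_paths:
  assumes "p \<in> G.paths" "q \<in> H.paths"
  shows "descent_word (G \<star> H) (join_paths p q) = descent_word G p * descent_word H q"
  using assms by (cases p rule: rev_cases; cases q)
    (auto simp: G.paths_def H.paths_def G.awalk_def H.awalk_def descent_word_star)

section \<open>Multiplicativity of \<open>Psi\<close>\<close>

lemma Psi_star: "Psi (G \<star> H) = Psi G * Psi H"
proof -
  have "Psi (G \<star> H) =
      (\<Sum>xs | xs \<noteq> [] \<and> star.awalk (Inl (zero_hat G)) xs (Inr (one_hat H)). descent_word (G \<star> H) xs)"
    unfolding Psi_def zero_hat_star one_hat_star by (simp add: star_def)
  also have "\<dots> = (\<Sum>(p, q)\<in>G.paths \<times> H.paths. descent_word (G \<star> H) (join_paths p q))"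
    by (subst sum.reindex_bij_betw[OF bij_betw_join_paths, symmetric])
      (simp add: case_prod_unfold)
  also have "\<dots> = (\<Sum>(p, q)\<in>G.paths \<times> H.paths. descent_word G p * descent_word H q)"
    by (intro sum.cong) (auto simp: descent_word_join_paths)
  \<comment> \<open>Distributivity; the factor from \<open>G\<close> stays on the left, as the ring
    is not commutative.\<close>
  also have "\<dots> = (\<Sum>p\<in>G.paths. descent_word G p) * (\<Sum>q\<in>H.paths. descent_word H q)"
    by (simp add: sum_product sum.cartesian_product)
  finally show ?thesis
    by (simp add: Psi_def G.paths_def H.paths_def)
qed

end

theorem theorem3p3:
  fixes G :: "('v, 'e, 'l) labeled_digraph"
    and H :: "('w, 'f, 'm) labeled_digraph"
  assumes "bounded_labeled_acyclic_digraph G"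
    and "bounded_labeled_acyclic_digraph H"
  shows "Psi (G \<star> H) = Psi G * Psi H"
proof -
  interpret star_product G H
    using assms by (simp add: star_product_def)
  show ?thesis
    by (rule Psi_star)
qed

end
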